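(* Let $k<t$ be positive integers and let $g$ be their greatest common divisor. Then $\chi_{\rho}(D(k,t))=\chi_{\rho}\left(D\left(\frac{k}{g},\frac{t}{g}\right)\right)$.
   Context: For positive integers $k<t$, the distance graph $D(k,t)$ is the infinite simple undirected graph with vertex set $\mathbb{Z}$ in which two distinct integers $i,j$ are adjacent if and only if $|i-j|\in\{k,t\}$. For a graph $G$, $\mathrm{dist}_G(u,v)$ denotes the graph distance, with the convention that it is $\infty$ when $u,v$ lie in different connected components. For a positive integer $i$, an $i$-packing is a set $X_i$ of vertices such that any two distinct $u,v\in X_i$ satisfy $\mathrm{dist}_G(u,v)>i$. A packing $p$-coloring of $G$ is a partition of $V(G)$ into disjoint (possibly empty) classes $X_1,\dots,X_p$ such that each $X_i$ is an $i$-packing. The packing chromatic number $\chi_\rho(G)$ is the smallest integer $p$ for which $G$ has a packing $p$-coloring. *)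

theory Defs
  imports
    "HOL-Library.Extended_Nat"
    "HOL-Library.Disjoint_Sets"
    "Graph_Theory.Pair_Digraph"
    "Graph_Theory.Shortest_Path"
begin

text \<open>
  A simple undirected graph is a symmetric loop-free digraph without parallel arcs, that is, a
  \<open>pair_bidirected_digraph\<close>. There is no finiteness assumption.
\<close>

definition distance_graph :: "nat \<Rightarrow> nat \<Rightarrow> int pair_pre_digraph" where
  "distance_graph k t =
     \<lparr> pverts = UNIV, parcs = {(i, j). i \<noteq> j \<and> \<bar>i - j\<bar> \<in> {int k, int t}} \<rparr>"

lemma pair_bidirected_digraph_distance_graph: "pair_bidirected_digraph (distance_graph k t)"
  by unfold_locales (auto simp: distance_graph_def symmetric_def sym_def abs_minus_commute)

definition graph_dist :: "'a pair_pre_digraph \<Rightarrow> 'a \<Rightarrow> 'a \<Rightarrow> ereal" where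
  "graph_dist G u v = wf_digraph.\<mu> (with_proj G) (\<lambda>_. 1) u v"

text \<open>
  Unit arc weights make the cost of a walk its length. The infimum over the empty set is
  \<open>\<infinity>\<close>, which is the value for vertices in different components.
\<close>

lemma (in pair_wf_digraph) graph_dist_conv_length:
  "graph_dist G u v = (INF p\<in>{p. awalk u p v}. ereal (real (length p)))"
proof -
  have "awalk_cost (\<lambda>_. 1) p = real (length p)" for p
    by (induction p) simp_all
  then show ?thesis
    by (simp add: graph_dist_def \<mu>_def)
qed

lemma (in pair_wf_digraph) graph_dist_unreachable:
  "\<not> u \<rightarrow>\<^sup>*\<^bsub>with_proj G\<^esub> v \<Longrightarrow> graph_dist G u v = \<infinity>"
  by (simp add: graph_dist_def shortest_path_inf)

definition packing :: "'a pair_pre_digraph \<Rightarrow> nat \<Rightarrow> 'a set \<Rightarrow> bool" where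
  "packing G i X \<longleftrightarrow> X \<subseteq> pverts G \<and>
     (\<forall>u\<in>X. \<forall>v\<in>X. u \<noteq> v \<longrightarrow> graph_dist G u v > ereal (real i))"

definition packing_coloring :: "'a pair_pre_digraph \<Rightarrow> nat \<Rightarrow> (nat \<Rightarrow> 'a set) \<Rightarrow> bool" where
  "packing_coloring G p X \<longleftrightarrow>
     (\<Union>i\<in>{1..p}. X i) = pverts G \<and> disjoint_family_on X {1..p} \<and> (\<forall>i\<in>{1..p}. packing G i (X i))"

text \<open>The value is \<open>\<infinity>\<close> if there is no packing coloring with finitely many classes.\<close>

definition packing_chromatic_number :: "'a pair_pre_digraph \<Rightarrow> enat" where
  "packing_chromatic_number G = Inf {enat p | p. \<exists>X. packing_coloring G p X}"

end

theory Submission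
  imports Defs
begin

text \<open>
  Packing colorings pull back along a graph homomorphism that never identifies two distinct vertices
  of the same component. Such a map does not increase distances, so two vertices of one color with
  distinct images are at least as far apart as their images; two vertices with the same image lie in
  different components, at distance \<open>\<infinity>\<close>, and may share any color. Hence the existence of
  such a map bounds the packing chromatic number of its domain by that of its codomain
  (\<open>packing_chromatic_number_le_if_hom\<close>).

  For \<open>a\<close>, \<open>b\<close> and \<open>g > 0\<close>, the graph of \<open>a * g\<close>, \<open>b * g\<close>
  consists of \<open>g\<close> disjoint copies of the graph of \<open>a\<close>, \<open>b\<close>, one on each residue
  class modulo \<open>g\<close>. Suitable maps exist in both directions: \<open>x \<mapsto> g * x\<close> embeds the
  smaller graph as the copy on the multiples of \<open>g\<close>, and \<open>x \<mapsto> x div g\<close> folds all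
  copies onto it.
\<close>

lemma awalk_map_hom:
  assumes "pair_wf_digraph H" and "pair_wf_digraph G"
    and verts: "f ` pverts H \<subseteq> pverts G"
    and arcs: "\<And>x y. (x, y) \<in> parcs H \<Longrightarrow> (f x, f y) \<in> parcs G"
    and "pre_digraph.awalk (with_proj H) u p v"
  shows "pre_digraph.awalk (with_proj G) (f u) (map (map_prod f f) p) (f v)"
proof -
  interpret H: pair_wf_digraph H by fact
  interpret G: pair_wf_digraph G by fact
  show ?thesis
    using \<open>pre_digraph.awalk (with_proj H) u p v\<close>
  proof (induction p arbitrary: u)
    case Nil
    then show ?case
      using verts by (auto simp: H.awalk_Nil_iff G.awalk_Nil_iff)
  next
    case (Cons e p)
    then show ?case
      using arcs by (cases e) (auto simp: H.awalk_Cons_iff G.awalk_Cons_iff)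
  qed
qed

lemma graph_dist_hom_le:
  assumes H: "pair_wf_digraph H" and G: "pair_wf_digraph G"
    and verts: "f ` pverts H \<subseteq> pverts G"
    and arcs: "\<And>x y. (x, y) \<in> parcs H \<Longrightarrow> (f x, f y) \<in> parcs G"
  shows "graph_dist G (f u) (f v) \<le> graph_dist H u v"
  unfolding pair_wf_digraph.graph_dist_conv_length[OF H] pair_wf_digraph.graph_dist_conv_length[OF G]
proof (rule INF_mono)
  fix p
  assume "p \<in> {p. pre_digraph.awalk (with_proj H) u p v}"
  then have "pre_digraph.awalk (with_proj G) (f u) (map (map_prod f f) p) (f v)"
    using awalk_map_hom[OF H G verts arcs] by simp
  then show "\<exists>q\<in>{q. pre_digraph.awalk (with_proj G) (f u) q (f v)}.
      ereal (real (length q)) \<le> ereal (real (length p))"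
    by (intro bexI[of _ "map (map_prod f f) p"]) auto
qed

text \<open>
  Injectivity on components is what makes preimages of packings packings: two vertices with the same
  image receive the same color, so they have to be infinitely far apart.
\<close>

lemma packing_coloring_vimage_hom:
  assumes H: "pair_wf_digraph H" and G: "pair_wf_digraph G"
    and verts: "f ` pverts H \<subseteq> pverts G"
    and arcs: "\<And>x y. (x, y) \<in> parcs H \<Longrightarrow> (f x, f y) \<in> parcs G"
    and inj: "\<And>x y. x \<rightarrow>\<^sup>*\<^bsub>with_proj H\<^esub> y \<Longrightarrow> f x = f y \<Longrightarrow> x = y"
    and col: "packing_coloring G p X"
  shows "packing_coloring H p (\<lambda>i. f -` X i \<inter> pverts H)"
proof -
  have "graph_dist H u v > ereal (real i)"
    if "packing G i (X i)" "f u \<in> X i" "f v \<in> X i" "u \<noteq> v" for i u v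
  proof (cases "f u = f v")
    case True
    then have "\<not> u \<rightarrow>\<^sup>*\<^bsub>with_proj H\<^esub> v"
      using inj \<open>u \<noteq> v\<close> by blast
    then show ?thesis
      by (simp add: pair_wf_digraph.graph_dist_unreachable[OF H])
  next
    case False
    then have "ereal (real i) < graph_dist G (f u) (f v)"
      using that by (auto simp: packing_def)
    also have "\<dots> \<le> graph_dist H u v"
      by (rule graph_dist_hom_le[OF H G verts arcs])
    finally show ?thesis .
  qed
  then have "\<forall>i\<in>{1..p}. packing H i (f -` X i \<inter> pverts H)"
    using col unfolding packing_coloring_def packing_def[of H] by blast
  moreover have "(\<Union>i\<in>{1..p}. f -` X i \<inter> pverts H) = pverts H"
    using col verts unfolding packing_coloring_def by blast
  moreover have "disjoint_family_on (\<lambda>i. f -` X i \<inter> pverts H) {1..p}"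
    using col unfolding packing_coloring_def disjoint_family_on_def by blast
  ultimately show ?thesis
    by (simp add: packing_coloring_def)
qed

lemma packing_chromatic_number_le_if_hom:
  assumes "pair_wf_digraph H" and "pair_wf_digraph G"
    and "f ` pverts H \<subseteq> pverts G"
    and "\<And>x y. (x, y) \<in> parcs H \<Longrightarrow> (f x, f y) \<in> parcs G"
    and "\<And>x y. x \<rightarrow>\<^sup>*\<^bsub>with_proj H\<^esub> y \<Longrightarrow> f x = f y \<Longrightarrow> x = y"
  shows "packing_chromatic_number H \<le> packing_chromatic_number G"
  unfolding packing_chromatic_number_def
  using packing_coloring_vimage_hom[OF assms] by (intro Inf_superset_mono) blast

lemma pair_wf_digraph_distance_graph: "pair_wf_digraph (distance_graph k t)"
proof -
  interpret pair_bidirected_digraph "distance_graph k t"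
    by (rule pair_bidirected_digraph_distance_graph)
  show ?thesis
    by unfold_locales
qed

lemma reachable_distance_graph_mod_eq:
  assumes "g dvd k" and "g dvd t" and "u \<rightarrow>\<^sup>*\<^bsub>with_proj (distance_graph k t)\<^esub> v"
  shows "u mod int g = v mod int g"
proof -
  interpret pair_wf_digraph "distance_graph k t"
    by (rule pair_wf_digraph_distance_graph)
  show ?thesis
    using assms(3)
  proof (induction rule: reachable_induct)
    case base
    show ?case ..
  next
    case (step x y)
    then have "\<bar>x - y\<bar> \<in> {int k, int t}"
      by (auto simp: distance_graph_def)
    then have "int g dvd \<bar>x - y\<bar>"
      using assms(1,2) by (auto simp del: dvd_abs_iff)
    then have "x mod int g = y mod int g"
      by (simp add: mod_eq_dvd_iff)
    then show ?case
      using step.IH by simp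
  qed
qed

lemma packing_chromatic_number_distance_graph_mult:
  assumes "0 < g"
  shows "packing_chromatic_number (distance_graph (a * g) (b * g)) =
         packing_chromatic_number (distance_graph a b)"
proof (rule antisym)
  let ?D = "distance_graph (a * g) (b * g)" and ?D' = "distance_graph a b"
  show "packing_chromatic_number ?D \<le> packing_chromatic_number ?D'"
  proof (rule packing_chromatic_number_le_if_hom[where f = "\<lambda>x. x div int g"])
    fix x y
    assume xy: "(x, y) \<in> parcs ?D"
    then obtain c where c: "c = a \<or> c = b" "\<bar>x - y\<bar> = int c * int g"
      by (auto simp: distance_graph_def)
    then have "x = y + int c * int g \<or> x = y + (- int c) * int g"
      by (auto simp: abs_if split: if_splits)
    then have "x div int g = y div int g + int c \<or> x div int g = y div int g - int c"
      using \<open>0 < g\<close> by (auto simp del: mult_minus_left)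
    \<comment> \<open>An arc of length \<open>0\<close> is excluded, so the images are distinct as well.\<close>
    moreover have "c \<noteq> 0"
      using xy c(2) by (intro notI) (simp add: distance_graph_def)
    ultimately show "(x div int g, y div int g) \<in> parcs ?D'"
      using c(1) by (auto simp: distance_graph_def)
  next
    fix x y
    assume "x \<rightarrow>\<^sup>*\<^bsub>with_proj ?D\<^esub> y" and "x div int g = y div int g"
    moreover from this have "x mod int g = y mod int g"
      by (intro reachable_distance_graph_mod_eq[of g "a * g" "b * g"]) auto
    ultimately show "x = y"
      by (metis div_mult_mod_eq)
  qed (rule pair_wf_digraph_distance_graph | simp add: distance_graph_def)+
  show "packing_chromatic_number ?D' \<le> packing_chromatic_number ?D"
  proof (rule packing_chromatic_number_le_if_hom[where f = "\<lambda>x. int g * x"])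
    fix x y
    assume "(x, y) \<in> parcs ?D'"
    moreover have "\<bar>int g * x - int g * y\<bar> = \<bar>x - y\<bar> * int g"
      by (simp add: abs_mult flip: right_diff_distrib)
    ultimately show "(int g * x, int g * y) \<in> parcs ?D"
      using \<open>0 < g\<close> by (auto simp: distance_graph_def)
  qed (rule pair_wf_digraph_distance_graph | use \<open>0 < g\<close> in \<open>simp add: distance_graph_def\<close>)+
qed

theorem proposition6:
  fixes k t g :: nat
  assumes "0 < k" and "k < t" and "g = gcd k t"
  shows "packing_chromatic_number (distance_graph k t) =
         packing_chromatic_number (distance_graph (k div g) (t div g))"
proof -
  have "0 < g" and "k div g * g = k" and "t div g * g = t"
    using assms by auto
  then show ?thesis
    using packing_chromatic_number_distance_graph_mult[of g "k div g" "t div g"] by simp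
qed

end
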